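(* Let $\gamma>\tfrac53$ and $\epsilon>0$, and consider the spatially homogeneous energy relaxation system in $\Omega^r$ $$\partial_t\mathbf w^\epsilon=-\frac1\epsilon\big(\mathbf w^\epsilon-\mathcal M(\mathbf w^\epsilon)\big),$$ that is: $\partial_t\rho_\alpha=0$ ($1\le\alpha\le n_s$), $\partial_t(\rho\mathbf v)=0$, $\partial_t(\rho_\beta e_\beta^v)=0$ ($1\le\beta\le n_d$), and $$\partial_t(\rho E_r)=\frac{\rho}{\epsilon}\big(e_s-F(\mathbf Y,e_r)\big),\qquad \partial_t(\rho e_s)=-\frac{\rho}{\epsilon}\big(e_s-F(\mathbf Y,e_r)\big),\qquad F(\mathbf Y,e_r)=\frac{\gamma-\gamma(\mathbf Y)}{\gamma(\mathbf Y)-1}e_r.$$ Then the vector of variables $\mathbf u=(\boldsymbol\rho,\rho\mathbf v,\rho E,(\rho_\beta e_\beta^v)_{\beta\le n_d})$ with $E=E_r+e_s+h_0+e_v$ is a constant of this system, and the entropy $\rho\zeta$ decreases in time and reaches a unique minimum, which corresponds to the equilibrium $$E=E_r+e_s+h_0+e_v,\qquad e_t=e_r+e_s,\qquad e_s=F(\mathbf Y,e_r).$$ This equilibrium is stable in the sense of Lyapunov.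
   Context: **Mixture.** Integers $d\ge1$, $1\le n_d\le n_s$. There are $n_s$ species; species $\alpha$ has gas constant $r_\alpha>0$, formation enthalpy $h_\alpha^0\ge0$, and $C_{v_\alpha}^t=\tfrac32r_\alpha$ (monoatomic) or $\tfrac52r_\alpha$ (diatomic). Species $1,\dots,n_d$ are diatomic species in thermal nonequilibrium, with constants $\vartheta_\beta^v>0$ and vibration energies $e_\beta^v$. Notation: partial densities $\rho_\alpha$, $\boldsymbol\rho=(\rho_1,\dots,\rho_{n_s})$, $\rho=\sum_\alpha\rho_\alpha$, $Y_\alpha=\rho_\alpha/\rho$ (so $\sum_\alpha Y_\alpha=1$), $\tau=1/\rho$, velocity $\mathbf v\in\mathbb R^d$, $h_0=\sum_\alpha Y_\alpha h_\alpha^0$, $e_v=\sum_{\beta\le n_d}Y_\beta e_\beta^v$, $\mathbf e_v=(e_\beta^v)_{\beta\le n_d}$, $r(\mathbf Y)=\sum_\alpha Y_\alpha r_\alpha$, $C_{v_t}(\mathbf Y)=\sum_\alpha Y_\alpha C_{v_\alpha}^t$, $\gamma(\mathbf Y)=1+r(\mathbf Y)/C_{v_t}(\mathbf Y)\in[\tfrac75,\tfrac53]$. The translation-rotation energy $e_t$ is related to the total energy $E$ by $E=h_0+e_t+e_v+\tfrac12|\mathbf v|^2$. **States.** $\mathbf w=(\boldsymbol\rho,\rho\mathbf v,\rho E_r,(\rho_\beta e_\beta^v)_{\beta\le n_d},\rho e_s)$, $e_r=E_r-\tfrac12|\mathbf v|^2$, and $\Omega^r=\{\mathbf w:\rho_\alpha>0\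 \forall\alpha,\ \mathbf v\in\mathbb R^d,\ e_r>0,\ e_\beta^v>0\ \forall\beta,\ e_s>0\}$. The map $\mathcal M$ is determined by $\mathbf w-\mathcal M(\mathbf w)=\big(0,0,\rho(F(\mathbf Y,e_r)-e_s),0,\rho(e_s-F(\mathbf Y,e_r))\big)$. **Mixture entropy.** $\mathrm s(\mathbf Y,\tau,e_t,\mathbf e_v)=C_{v_t}(\mathbf Y)\ln e_t+r(\mathbf Y)\ln\tau+K(\mathbf Y)+\sum_{\beta\le n_d}Y_\beta\mathrm s_\beta^v(e_\beta^v)$, with $K(\mathbf Y)=\sum_\alpha Y_\alpha\big(C_{v_\alpha}^t\ln\tfrac{C_{v_\alpha}^t}{C_{v_t}(\mathbf Y)}-r_\alpha\ln Y_\alpha\big)$ and $\mathrm s_\beta^v(e)=r_\beta\ln e+r_\beta\big(1+\tfrac{e}{r_\beta\vartheta_\beta^v}\big)\ln\big(1+\tfrac{r_\beta\vartheta_\beta^v}{e}\big)$. **Relaxation entropy.** $\zeta(\mathbf w)=-\mathrm s\big(\mathbf Y,\mathcal T,\mathcal E+e_s,\mathbf e_v\big)$, where $\mathcal E=\tfrac{\gamma(\mathbf Y)-1}{\gamma-\gamma(\mathbf Y)}e_s$, $\mathcal T=\big(\tfrac{\gamma-\gamma(\mathbf Y)}{\gamma(\mathbf Y)-1}\tfrac{(-\mathrm s_r)^\gamma}{e_s}\big)^{1/(\gamma-1)}$ and $\mathrm s_r=-(\tau^{\gamma-1}e_r)^{1/\gamma}$. *)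

theory Defs
  imports "HOL-Analysis.Analysis"
begin

section \<open>Mixture\<close>

text \<open>
  The index type \<open>'s\<close> stands for the species and \<open>'b\<close> for the species in vibrational
  nonequilibrium; the injection \<open>noneq\<close> identifies the latter with species, so that
  \<open>1 \<le> CARD('b) \<le> CARD('s)\<close>.  The species outside the range of \<open>noneq\<close> may be monoatomic
  or diatomic.
\<close>

record ('s, 'b) mixture =
  gas_const :: "'s \<Rightarrow> real"
  form_enth :: "'s \<Rightarrow> real"
  diatomic :: "'s set"
  noneq :: "'b \<Rightarrow> 's"
  vib_temp :: "'b \<Rightarrow> real"

definition valid_mixture :: "('s, 'b) mixture \<Rightarrow> bool" where
  "valid_mixture X \<longleftrightarrow>
     (\<forall>\<alpha>. gas_const X \<alpha> > 0) \<and> (\<forall>\<alpha>. form_enth X \<alpha> \<ge> 0) \<and>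
     inj (noneq X) \<and> range (noneq X) \<subseteq> diatomic X \<and> (\<forall>\<beta>. vib_temp X \<beta> > 0)"

definition Cv :: "('s, 'b) mixture \<Rightarrow> 's \<Rightarrow> real" where
  "Cv X \<alpha> = (if \<alpha> \<in> diatomic X then 5/2 * gas_const X \<alpha> else 3/2 * gas_const X \<alpha>)"

definition mass :: "real ^ 's::finite \<Rightarrow> real" where
  "mass \<rho> = (\<Sum>\<alpha>\<in>UNIV. \<rho> $ \<alpha>)"

definition mass_frac :: "real ^ 's::finite \<Rightarrow> real ^ 's" where
  "mass_frac \<rho> = (\<chi> \<alpha>. \<rho> $ \<alpha> / mass \<rho>)"

definition r_mix :: "('s::finite, 'b) mixture \<Rightarrow> real ^ 's \<Rightarrow> real" where
  "r_mix X Y = (\<Sum>\<alpha>\<in>UNIV. Y $ \<alpha> * gas_const X \<alpha>)"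

definition Cv_mix :: "('s::finite, 'b) mixture \<Rightarrow> real ^ 's \<Rightarrow> real" where
  "Cv_mix X Y = (\<Sum>\<alpha>\<in>UNIV. Y $ \<alpha> * Cv X \<alpha>)"

definition gamma_mix :: "('s::finite, 'b) mixture \<Rightarrow> real ^ 's \<Rightarrow> real" where
  "gamma_mix X Y = 1 + r_mix X Y / Cv_mix X Y"

definition h0_mix :: "('s::finite, 'b) mixture \<Rightarrow> real ^ 's \<Rightarrow> real" where
  "h0_mix X Y = (\<Sum>\<alpha>\<in>UNIV. Y $ \<alpha> * form_enth X \<alpha>)"

definition ev_mix :: "('s::finite, 'b::finite) mixture \<Rightarrow> real ^ 's \<Rightarrow> real ^ 'b \<Rightarrow> real" where
  "ev_mix X Y e = (\<Sum>\<beta>\<in>UNIV. Y $ noneq X \<beta> * e $ \<beta>)"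


section \<open>Mixture entropy\<close>

definition vib_entropy :: "real \<Rightarrow> real \<Rightarrow> real \<Rightarrow> real" where
  "vib_entropy r \<theta> e = r * ln e + r * (1 + e / (r * \<theta>)) * ln (1 + r * \<theta> / e)"

definition K_mix :: "('s::finite, 'b) mixture \<Rightarrow> real ^ 's \<Rightarrow> real" where
  "K_mix X Y =
     (\<Sum>\<alpha>\<in>UNIV. Y $ \<alpha> * (Cv X \<alpha> * ln (Cv X \<alpha> / Cv_mix X Y) - gas_const X \<alpha> * ln (Y $ \<alpha>)))"

definition mix_entropy ::
  "('s::finite, 'b::finite) mixture \<Rightarrow> real ^ 's \<Rightarrow> real \<Rightarrow> real \<Rightarrow> real ^ 'b \<Rightarrow> real" where
  "mix_entropy X Y \<tau> e\<^sub>t e =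
     Cv_mix X Y * ln e\<^sub>t + r_mix X Y * ln \<tau> + K_mix X Y +
     (\<Sum>\<beta>\<in>UNIV. Y $ noneq X \<beta> * vib_entropy (gas_const X (noneq X \<beta>)) (vib_temp X \<beta>) (e $ \<beta>))"


section \<open>States\<close>

text \<open>
  Both kinds of states are in conservative form:
  \<open>w = (\<rho>\<^sub>\<alpha>, \<rho>v, \<rho>E\<^sub>r, \<rho>\<^sub>\<beta>e\<^sub>\<beta>, \<rho>e\<^sub>s)\<close> for the relaxation system and
  \<open>u = (\<rho>\<^sub>\<alpha>, \<rho>v, \<rho>E, \<rho>\<^sub>\<beta>e\<^sub>\<beta>)\<close> for the mixture.
\<close>

type_synonym ('s, 'd, 'b) relax_state =
  "(real ^ 's) \<times> (real ^ 'd) \<times> real \<times> (real ^ 'b) \<times> real"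

type_synonym ('s, 'd, 'b) mix_state =
  "(real ^ 's) \<times> (real ^ 'd) \<times> real \<times> (real ^ 'b)"

definition kinetic :: "real ^ 's::finite \<Rightarrow> real ^ 'd::finite \<Rightarrow> real" where
  "kinetic \<rho> m = 1/2 * (norm (m /\<^sub>R mass \<rho>))\<^sup>2"

definition vib_energy ::
  "('s::finite, 'b::finite) mixture \<Rightarrow> real ^ 's \<Rightarrow> real ^ 'b \<Rightarrow> real ^ 'b" where
  "vib_energy X \<rho> q = (\<chi> \<beta>. q $ \<beta> / \<rho> $ noneq X \<beta>)"

fun Er :: "('s::finite, 'd::finite, 'b::finite) relax_state \<Rightarrow> real" where
  "Er (\<rho>, m, a, q, b) = a / mass \<rho>"

fun er :: "('s::finite, 'd::finite, 'b::finite) relax_state \<Rightarrow> real" where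
  "er (\<rho>, m, a, q, b) = Er (\<rho>, m, a, q, b) - kinetic \<rho> m"

fun es :: "('s::finite, 'd::finite, 'b::finite) relax_state \<Rightarrow> real" where
  "es (\<rho>, m, a, q, b) = b / mass \<rho>"

definition Omega_r ::
  "('s::finite, 'b::finite) mixture \<Rightarrow> ('s, 'd::finite, 'b) relax_state set" where
  "Omega_r X =
     {(\<rho>, m, a, q, b) | \<rho> m a q b.
        (\<forall>\<alpha>. \<rho> $ \<alpha> > 0) \<and> er (\<rho>, m, a, q, b) > 0 \<and>
        (\<forall>\<beta>. vib_energy X \<rho> q $ \<beta> > 0) \<and> es (\<rho>, m, a, q, b) > 0}"

text \<open>The total energy \<open>E = E\<^sub>r + e\<^sub>s + h\<^sub>0 + e\<^sub>v\<close> and the vector \<open>u\<close> determined by \<open>w\<close>.\<close>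

fun E_relax ::
  "('s::finite, 'b::finite) mixture \<Rightarrow> ('s, 'd::finite, 'b) relax_state \<Rightarrow> real" where
  "E_relax X (\<rho>, m, a, q, b) =
     Er (\<rho>, m, a, q, b) + es (\<rho>, m, a, q, b) +
     h0_mix X (mass_frac \<rho>) + ev_mix X (mass_frac \<rho>) (vib_energy X \<rho> q)"

fun cons_var ::
  "('s::finite, 'b::finite) mixture \<Rightarrow> ('s, 'd::finite, 'b) relax_state
     \<Rightarrow> ('s, 'd, 'b) mix_state" where
  "cons_var X (\<rho>, m, a, q, b) = (\<rho>, m, mass \<rho> * E_relax X (\<rho>, m, a, q, b), q)"

text \<open>\<open>e\<^sub>t\<close> of a mixture state is obtained by solving \<open>E = h\<^sub>0 + e\<^sub>t + e\<^sub>v + |v|\<^sup>2/2\<close>.\<close>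

fun E_mix :: "('s::finite, 'd::finite, 'b::finite) mix_state \<Rightarrow> real" where
  "E_mix (\<rho>, m, c, q) = c / mass \<rho>"

fun et_mix ::
  "('s::finite, 'b::finite) mixture \<Rightarrow> ('s, 'd::finite, 'b) mix_state \<Rightarrow> real" where
  "et_mix X (\<rho>, m, c, q) =
     E_mix (\<rho>, m, c, q) - h0_mix X (mass_frac \<rho>)
     - ev_mix X (mass_frac \<rho>) (vib_energy X \<rho> q) - kinetic \<rho> m"


section \<open>Relaxation system\<close>

definition F_relax :: "('s::finite, 'b) mixture \<Rightarrow> real \<Rightarrow> real ^ 's \<Rightarrow> real \<Rightarrow> real" where
  "F_relax X \<gamma> Y e = (\<gamma> - gamma_mix X Y) / (gamma_mix X Y - 1) * e"

fun relax_map ::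
  "('s::finite, 'b::finite) mixture \<Rightarrow> real \<Rightarrow> ('s, 'd::finite, 'b) relax_state
     \<Rightarrow> ('s, 'd, 'b) relax_state" where
  "relax_map X \<gamma> (\<rho>, m, a, q, b) =
     (let w = (\<rho>, m, a, q, b); F = F_relax X \<gamma> (mass_frac \<rho>) (er w)
      in w - (0, 0, mass \<rho> * (F - es w), 0, mass \<rho> * (es w - F)))"

definition relax_field ::
  "('s::finite, 'b::finite) mixture \<Rightarrow> real \<Rightarrow> real \<Rightarrow> ('s, 'd::finite, 'b) relax_state
     \<Rightarrow> ('s, 'd, 'b) relax_state" where
  "relax_field X \<gamma> \<epsilon> w = - ((1 / \<epsilon>) *\<^sub>R (w - relax_map X \<gamma> w))"

lemma relax_field_components:
  fixes m :: "real ^ 'd::finite"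
  assumes "w = (\<rho>, m, a, q, b)" and "F = F_relax X \<gamma> (mass_frac \<rho>) (er w)"
  shows "relax_field X \<gamma> \<epsilon> w =
           (0, 0, mass \<rho> / \<epsilon> * (es w - F), 0, - (mass \<rho> / \<epsilon> * (es w - F)))"
  using assms by (simp add: relax_field_def Let_def algebra_simps)

definition ode_solution ::
  "('a::real_normed_vector \<Rightarrow> 'a) \<Rightarrow> 'a set \<Rightarrow> real set \<Rightarrow> (real \<Rightarrow> 'a) \<Rightarrow> bool" where
  "ode_solution f D I x \<longleftrightarrow>
     (\<forall>t\<in>I. x t \<in> D \<and> (x has_vector_derivative f (x t)) (at t within I))"

text \<open>
  Stability in the sense of Lyapunov, for the equation \<open>x' = f x\<close> in the phase space \<open>D\<close>:
  solutions starting near \<open>p\<close> exist for all positive times and stay near \<open>p\<close>.  No uniqueness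
  of solutions is presupposed, hence the quantification over all solutions.
\<close>

definition lyapunov_stable ::
  "('a::real_normed_vector \<Rightarrow> 'a) \<Rightarrow> 'a set \<Rightarrow> 'a \<Rightarrow> bool" where
  "lyapunov_stable f D p \<longleftrightarrow>
     p \<in> D \<and> f p = 0 \<and>
     (\<forall>\<eta>>0. \<exists>\<delta>>0. \<forall>x\<^sub>0\<in>D. dist x\<^sub>0 p < \<delta> \<longrightarrow>
        (\<exists>x. ode_solution f D {0..} x \<and> x 0 = x\<^sub>0) \<and>
        (\<forall>I x. is_interval I \<and> 0 \<in> I \<and> I \<subseteq> {0..} \<and> ode_solution f D I x \<and> x 0 = x\<^sub>0 \<longrightarrow>
           (\<forall>t\<in>I. dist (x t) p < \<eta>)))"


section \<open>Relaxation entropy and equilibrium\<close>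

fun zeta ::
  "('s::finite, 'b::finite) mixture \<Rightarrow> real \<Rightarrow> ('s, 'd::finite, 'b) relax_state \<Rightarrow> real" where
  "zeta X \<gamma> (\<rho>, m, a, q, b) =
     (let w = (\<rho>, m, a, q, b);
          Y = mass_frac \<rho>;
          \<tau> = 1 / mass \<rho>;
          g = gamma_mix X Y;
          s\<^sub>r = - ((\<tau> powr (\<gamma> - 1) * er w) powr (1 / \<gamma>));
          \<E> = (g - 1) / (\<gamma> - g) * es w;
          \<T> = ((\<gamma> - g) / (g - 1) * ((- s\<^sub>r) powr \<gamma> / es w)) powr (1 / (\<gamma> - 1))
      in - mix_entropy X Y \<T> (\<E> + es w) (vib_energy X \<rho> q))"

fun rho_zeta ::
  "('s::finite, 'b::finite) mixture \<Rightarrow> real \<Rightarrow> ('s, 'd::finite, 'b) relax_state \<Rightarrow> real" where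
  "rho_zeta X \<gamma> (\<rho>, m, a, q, b) = mass \<rho> * zeta X \<gamma> (\<rho>, m, a, q, b)"

text \<open>\<open>w\<close> is the equilibrium state that corresponds to the mixture state \<open>u\<close>.\<close>

fun equilibrium ::
  "('s::finite, 'b::finite) mixture \<Rightarrow> real \<Rightarrow> ('s, 'd::finite, 'b) mix_state
     \<Rightarrow> ('s, 'd, 'b) relax_state \<Rightarrow> bool" where
  "equilibrium X \<gamma> (\<rho>\<^sub>u, m\<^sub>u, c, q\<^sub>u) (\<rho>, m, a, q, b) \<longleftrightarrow>
     (let u = (\<rho>\<^sub>u, m\<^sub>u, c, q\<^sub>u); w = (\<rho>, m, a, q, b); Y = mass_frac \<rho> in
        w \<in> Omega_r X \<and> \<rho> = \<rho>\<^sub>u \<and> m = m\<^sub>u \<and> q = q\<^sub>u \<and>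
        E_mix u = Er w + es w + h0_mix X Y + ev_mix X Y (vib_energy X \<rho> q) \<and>
        et_mix X u = er w + es w \<and>
        es w = F_relax X \<gamma> Y (er w))"

end

theory Submission
  imports Defs
begin

text \<open>
  Along the relaxation system \<open>\<rho>\<^sub>\<alpha>\<close>, \<open>\<rho>v\<close>, \<open>\<rho>\<^sub>\<beta>e\<^sub>\<beta>\<close> and \<open>\<rho>(E\<^sub>r + e\<^sub>s)\<close> are invariant, and on a
  level set of these invariants the field is affine: it equals \<open>- \<lambda> (w - p)\<close> with
  \<open>\<lambda> = (1 + \<kappa>) / \<epsilon>\<close>, \<open>\<kappa> = (\<gamma> - \<gamma>(Y)) / (\<gamma>(Y) - 1) > 0\<close>, and \<open>p\<close> the only equilibrium in the level set.
  Hence every solution is \<open>p + exp (- \<lambda> t) (w\<^sub>0 - p)\<close>, and stability follows from the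
  continuity of \<open>p\<close> as a function of \<open>w\<^sub>0\<close>.  Since \<open>C\<^sub>v\<^sub>t (\<gamma> - \<gamma>(Y)) = \<kappa> r\<close>, the entropy on a level
  set is \<open>const - r / (\<gamma> - 1) (\<kappa> ln e\<^sub>s + ln e\<^sub>r)\<close>, strictly convex along \<open>e\<^sub>r + e\<^sub>s = const\<close> with
  minimum at \<open>e\<^sub>s = \<kappa> e\<^sub>r\<close>, so it decreases on the segment towards \<open>p\<close>.
\<close>

section \<open>Invariants, equilibrium state and explicit trajectory\<close>

text \<open>The slope of \<open>F_relax\<close> in its energy argument. It depends on the densities
  alone, hence is constant along solutions.\<close>

definition kappa :: "('s::finite, 'b) mixture \<Rightarrow> real \<Rightarrow> real ^ 's \<Rightarrow> real" where
  "kappa X \<gamma> \<rho> = (\<gamma> - gamma_mix X (mass_frac \<rho>)) / (gamma_mix X (mass_frac \<rho>) - 1)"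

text \<open>The component \<open>a + b\<close> is \<open>\<rho>(E\<^sub>r + e\<^sub>s)\<close>.\<close>

fun invariants ::
  "('s::finite, 'd::finite, 'b::finite) relax_state \<Rightarrow> (real ^ 's) \<times> (real ^ 'd) \<times> real \<times> (real ^ 'b)" where
  "invariants (\<rho>, m, a, q, b) = (\<rho>, m, a + b, q)"

text \<open>Here \<open>a + b - |\<rho>v|\<^sup>2/(2\<rho>)\<close> is \<open>\<rho>(e\<^sub>r + e\<^sub>s)\<close>, split in the ratio \<open>e\<^sub>s = \<kappa> e\<^sub>r\<close>.\<close>

fun relaxed ::
  "('s::finite, 'b::finite) mixture \<Rightarrow> real \<Rightarrow> ('s, 'd::finite, 'b) relax_state \<Rightarrow> ('s, 'd, 'b) relax_state" where
  "relaxed X \<gamma> (\<rho>, m, a, q, b) =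
     (let b' = kappa X \<gamma> \<rho> / (1 + kappa X \<gamma> \<rho>) * (a + b - mass \<rho> * kinetic \<rho> m)
      in (\<rho>, m, a + b - b', q, b'))"

definition relax_rate ::
  "('s::finite, 'b::finite) mixture \<Rightarrow> real \<Rightarrow> real \<Rightarrow> ('s, 'd::finite, 'b) relax_state \<Rightarrow> real" where
  "relax_rate X \<gamma> \<epsilon> w = (1 + kappa X \<gamma> (fst w)) / \<epsilon>"

definition relax_path ::
  "('s::finite, 'b::finite) mixture \<Rightarrow> real \<Rightarrow> real \<Rightarrow> ('s, 'd::finite, 'b) relax_state
     \<Rightarrow> real \<Rightarrow> ('s, 'd, 'b) relax_state" where
  "relax_path X \<gamma> \<epsilon> w t =
     relaxed X \<gamma> w + exp (- (relax_rate X \<gamma> \<epsilon> w * t)) *\<^sub>R (w - relaxed X \<gamma> w)"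

lemma invariants_eq:
  "invariants w = (fst w, fst (snd w), fst (snd (snd w)) + snd (snd (snd (snd w))), fst (snd (snd (snd w))))"
  by (cases w) simp

text \<open>Linearity lets the time derivative and the affine combinations in
  \<open>relax_path\<close> pass through \<open>invariants\<close>.\<close>

lemma bounded_linear_invariants: "bounded_linear invariants"
  unfolding invariants_eq
  by (intro bounded_linear_Pair bounded_linear_add bounded_linear_fst_comp
      bounded_linear_snd_comp bounded_linear_ident)

section \<open>Positivity and bounds for the mixture coefficients\<close>

lemma mass_pos:
  fixes \<rho> :: "real ^ 's::finite"
  assumes "\<forall>\<alpha>. \<rho> $ \<alpha> > 0" shows "mass \<rho> > 0"
  unfolding mass_def using assms by (intro sum_pos) auto

text \<open>Multiplying by the positive mass turns the conditions on \<open>er\<close> and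
  \<open>es\<close> into strict lower bounds on \<open>a\<close> and \<open>b\<close>, which are
  convex conditions once \<open>\<rho>\<close> and \<open>m\<close> are fixed.\<close>

lemma Omega_r_iff:
  "(\<rho>, m, a, q, b) \<in> Omega_r X \<longleftrightarrow>
     (\<forall>\<alpha>. \<rho> $ \<alpha> > 0) \<and> mass \<rho> * kinetic \<rho> m < a \<and> (\<forall>\<beta>. vib_energy X \<rho> q $ \<beta> > 0) \<and> b > 0"
  using mass_pos[of \<rho>]
  by (auto simp: Omega_r_def field_simps)

text \<open>The ratio of \<open>gas_const\<close> to \<open>Cv\<close> is 2/3 for monoatomic and 2/5
  for diatomic species, so summation with positive weights bounds \<open>r_mix\<close> by 2/3 of
  \<open>Cv_mix\<close>. Thus \<open>\<gamma> > 5/3\<close> suffices for \<open>kappa\<close> to be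
  positive.\<close>

lemma mixture_bounds:
  fixes X :: "('s::finite, 'b) mixture"
  assumes X: "valid_mixture X" and \<rho>: "\<forall>\<alpha>. \<rho> $ \<alpha> > 0"
  shows r_mix_pos: "r_mix X (mass_frac \<rho>) > 0"
    and Cv_mix_pos: "Cv_mix X (mass_frac \<rho>) > 0"
    and gamma_mix_gt: "gamma_mix X (mass_frac \<rho>) > 1"
    and gamma_mix_le: "gamma_mix X (mass_frac \<rho>) \<le> 5/3"
proof -
  have Y: "mass_frac \<rho> $ \<alpha> > 0" for \<alpha>
    using \<rho> mass_pos[OF \<rho>] by (simp add: mass_frac_def)
  have r: "gas_const X \<alpha> > 0" for \<alpha>
    using X by (simp add: valid_mixture_def)
  have c: "Cv X \<alpha> > 0" "2/3 * Cv X \<alpha> \<ge> gas_const X \<alpha>" for \<alpha>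
    using r[of \<alpha>] by (auto simp: Cv_def)
  show r0: "r_mix X (mass_frac \<rho>) > 0" and C0: "Cv_mix X (mass_frac \<rho>) > 0"
    unfolding r_mix_def Cv_mix_def using Y r c by (auto intro!: sum_pos)
  have "r_mix X (mass_frac \<rho>) \<le> (\<Sum>\<alpha>\<in>UNIV. mass_frac \<rho> $ \<alpha> * (2/3 * Cv X \<alpha>))"
    unfolding r_mix_def using Y c by (intro sum_mono mult_left_mono) (auto intro: less_imp_le)
  also have "\<dots> = 2/3 * Cv_mix X (mass_frac \<rho>)"
    by (simp add: Cv_mix_def sum_distrib_left algebra_simps)
  finally show "gamma_mix X (mass_frac \<rho>) \<le> 5/3"
    using C0 by (simp add: gamma_mix_def field_simps)
  show "gamma_mix X (mass_frac \<rho>) > 1"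
    using r0 C0 by (simp add: gamma_mix_def)
qed

lemma kappa_pos:
  assumes "valid_mixture X" "\<gamma> > 5/3" "\<forall>\<alpha>. \<rho> $ \<alpha> > 0"
  shows "kappa X \<gamma> \<rho> > 0"
  using gamma_mix_gt[OF assms(1,3)] gamma_mix_le[OF assms(1,3)] assms(2) by (simp add: kappa_def)

lemma F_relax_eq: "F_relax X \<gamma> (mass_frac \<rho>) e = kappa X \<gamma> \<rho> * e"
  by (simp add: F_relax_def kappa_def)

section \<open>Level sets of the invariants and the equilibrium in each\<close>

text \<open>The total energy differs from \<open>(a + b) / mass \<rho>\<close> by formation and
  vibration terms that depend on \<open>\<rho>\<close> and \<open>q\<close> alone, and these are
  components of both vectors.\<close>

lemma cons_var_eq_iff:
  assumes "\<forall>\<alpha>. fst w $ \<alpha> > 0"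
  shows "cons_var X w = cons_var X w' \<longleftrightarrow> invariants w = invariants w'"
  using mass_pos[OF assms]
  by (cases w; cases w') (auto simp: add_divide_distrib[symmetric])

text \<open>Since \<open>a\<close> and \<open>b\<close> enter only through their sum, all states of
  a level set share one target.\<close>

lemma relaxed_cong: "invariants w = invariants w' \<Longrightarrow> relaxed X \<gamma> w = relaxed X \<gamma> w'"
  by (cases w; cases w') (auto simp: Let_def)

lemma invariants_relaxed [simp]: "invariants (relaxed X \<gamma> w) = invariants w"
  by (cases w) (simp add: Let_def)

lemma relax_rate_cong: "invariants w = invariants w' \<Longrightarrow> relax_rate X \<gamma> \<epsilon> w = relax_rate X \<gamma> \<epsilon> w'"
  by (cases w; cases w') (simp add: relax_rate_def)

lemma Omega_rD: "w \<in> Omega_r X \<Longrightarrow> \<forall>\<alpha>. fst w $ \<alpha> > 0"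
  by (auto simp: Omega_r_def)

text \<open>The weight \<open>kappa / (1 + kappa)\<close> lies strictly between 0 and 1, so both
  shares of the positive quantity \<open>mass \<rho> * (er w + es w)\<close> are positive.\<close>

lemma relaxed_in_Omega_r:
  assumes X: "valid_mixture X" "\<gamma> > 5/3" and w: "w \<in> Omega_r X"
  shows "relaxed X \<gamma> w \<in> Omega_r X"
proof (cases w)
  case (fields \<rho> m a q b)
  have k: "kappa X \<gamma> \<rho> > 0"
    using kappa_pos[OF X Omega_rD[OF w]] fields by simp
  have S: "a + b - mass \<rho> * kinetic \<rho> m > 0"
    using w fields by (simp add: Omega_r_iff)
  have "0 < kappa X \<gamma> \<rho> / (1 + kappa X \<gamma> \<rho>) * (a + b - mass \<rho> * kinetic \<rho> m)"
    using k S by simp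
  moreover have "kappa X \<gamma> \<rho> / (1 + kappa X \<gamma> \<rho>) * (a + b - mass \<rho> * kinetic \<rho> m)
      < 1 * (a + b - mass \<rho> * kinetic \<rho> m)"
    using k S by (intro mult_strict_right_mono) auto
  ultimately show ?thesis
    using w fields by (simp add: Omega_r_iff Let_def)
qed

text \<open>Once \<open>\<rho>\<close>, \<open>m\<close>, \<open>q\<close> and \<open>a + b\<close>
  are prescribed, the relation between \<open>es\<close> and \<open>er\<close> is a single linear
  equation for \<open>b\<close> with exactly one solution.\<close>

lemma equilibrium_iff:
  assumes X: "valid_mixture X" "\<gamma> > 5/3" and w0: "w\<^sub>0 \<in> Omega_r X"
  shows "equilibrium X \<gamma> (cons_var X w\<^sub>0) w \<longleftrightarrow> w = relaxed X \<gamma> w\<^sub>0"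
proof (cases w; cases w\<^sub>0)
  fix \<rho> m a q b \<rho>' m' a' q' b'
  assume w: "w = (\<rho>, m, a, q, b)" and w': "w\<^sub>0 = (\<rho>', m', a', q', b')"
  have \<rho>: "\<forall>\<alpha>. \<rho>' $ \<alpha> > 0" using Omega_rD[OF w0] w' by simp
  note k = kappa_pos[OF X \<rho>] and M = mass_pos[OF \<rho>]
  let ?k = "kappa X \<gamma> \<rho>'" and ?K = "mass \<rho>' * kinetic \<rho>' m'"
  have b: "b / mass \<rho>' = ?k * (a / mass \<rho>' - kinetic \<rho>' m') \<longleftrightarrow> b = ?k / (1 + ?k) * (a + b - ?K)"
    using k M by (simp add: field_simps)
  have "relaxed X \<gamma> w\<^sub>0 \<in> Omega_r X" by (rule relaxed_in_Omega_r[OF X w0])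
  moreover have eq: "equilibrium X \<gamma> (cons_var X w\<^sub>0) w \<longleftrightarrow>
      w \<in> Omega_r X \<and> \<rho> = \<rho>' \<and> m = m' \<and> q = q' \<and> a + b = a' + b' \<and>
      b / mass \<rho>' = ?k * (a / mass \<rho>' - kinetic \<rho>' m')"
  proof -
    \<comment> \<open>The conditions on \<open>E\<close> and on the translation-rotation energy both
      amount to equality of the sums; \<open>h\<close> and \<open>e\<close> stand for the common
      values of \<open>h0_mix\<close> and \<open>ev_mix\<close>.\<close>
    have "a' / mass \<rho>' + b' / mass \<rho>' + h + e = a / mass \<rho>' + b / mass \<rho>' + h + e \<and>
        a' / mass \<rho>' + b' / mass \<rho>' + h + e - h - e - kinetic \<rho>' m' =
          a / mass \<rho>' - kinetic \<rho>' m' + b / mass \<rho>' \<longleftrightarrow> a + b = a' + b'" for h e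
    proof -
      have "a' / mass \<rho>' + b' / mass \<rho>' = a / mass \<rho>' + b / mass \<rho>' \<longleftrightarrow> a + b = a' + b'"
        using M by (auto simp: add_divide_distrib[symmetric])
      then show ?thesis by linarith
    qed
    then show ?thesis
      using M unfolding w w' by (auto simp: Let_def F_relax_eq)
  qed
  ultimately show ?thesis
    using b unfolding eq w w' by (auto simp: Let_def)
qed

section \<open>The affine field and its solutions\<close>

text \<open>With \<open>b'\<close> the last component of \<open>relaxed X \<gamma> w\<close>, the
  product of the mass and \<open>es w - kappa * er w\<close> is
  \<open>(1 + kappa) * (b - b')\<close>. The component \<open>a\<close> deviates from its target by
  the opposite amount.\<close>

lemma relax_field_eq:
  assumes X: "valid_mixture X" "\<gamma> > 5/3" and w: "w \<in> Omega_r X"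
  shows "relax_field X \<gamma> \<epsilon> w = - (relax_rate X \<gamma> \<epsilon> w *\<^sub>R (w - relaxed X \<gamma> w))"
proof (cases w)
  case (fields \<rho> m a q b)
  have \<rho>: "\<forall>\<alpha>. \<rho> $ \<alpha> > 0" using Omega_rD[OF w] fields by simp
  note k = kappa_pos[OF X \<rho>] and M = mass_pos[OF \<rho>]
  have "mass \<rho> / \<epsilon> * (b / mass \<rho> - kappa X \<gamma> \<rho> * (a / mass \<rho> - kinetic \<rho> m)) =
     (1 + kappa X \<gamma> \<rho>) / \<epsilon> * (b - kappa X \<gamma> \<rho> / (1 + kappa X \<gamma> \<rho>) * (a + b - mass \<rho> * kinetic \<rho> m))"
    using k M by (simp add: divide_simps) (simp add: algebra_simps)
  then show ?thesis
    unfolding relax_field_components[OF fields refl]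
    by (simp add: fields relax_rate_def Let_def F_relax_eq algebra_simps)
qed

text \<open>Both ends share \<open>\<rho>\<close>, \<open>m\<close> and \<open>q\<close>, so only
  the lower bounds on \<open>a\<close> and \<open>b\<close> are at stake, and a half-line is
  convex.\<close>

lemma relaxed_segment_in_Omega_r:
  assumes X: "valid_mixture X" "\<gamma> > 5/3" and w: "w \<in> Omega_r X" and \<theta>: "0 \<le> \<theta>" "\<theta> \<le> 1"
  shows "relaxed X \<gamma> w + \<theta> *\<^sub>R (w - relaxed X \<gamma> w) \<in> Omega_r X"
proof -
  obtain \<rho> m a q b where w_eq: "w = (\<rho>, m, a, q, b)" by (cases w)
  obtain a' b' where p_eq: "relaxed X \<gamma> w = (\<rho>, m, a', q, b')" using w_eq by (simp add: Let_def)
  have p: "relaxed X \<gamma> w \<in> Omega_r X" by (rule relaxed_in_Omega_r[OF X w])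
  have conv: "c < x + \<theta> * (y - x)" if "c < x" "c < y" for c x y :: real
  proof -
    have "x + \<theta> * (y - x) \<in> {c<..}"
      using convexD_alt[OF convex_real_interval(3)[of c], of x y \<theta>] that \<theta> by (simp add: algebra_simps)
    then show ?thesis by simp
  qed
  show ?thesis
    using w p conv[of "mass \<rho> * kinetic \<rho> m" a' a] conv[of 0 b' b]
    unfolding p_eq by (simp add: w_eq Omega_r_iff)
qed

lemma has_vector_derivative_zero_imp_eq:
  assumes "convex I" and "\<And>t. t \<in> I \<Longrightarrow> (f has_vector_derivative 0) (at t within I)"
    and "s \<in> I" "t \<in> I"
  shows "f s = f t"
  by (rule has_vector_derivative_zero_constant[OF assms(1,2)]) (auto simp: assms(3,4))

text \<open>Uniqueness by direct integration. The two times may come in either order.\<close>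

lemma solution_eq:
  assumes X: "valid_mixture X" "\<gamma> > 5/3"
    and I: "is_interval I" and sol: "ode_solution (relax_field X \<gamma> \<epsilon>) (Omega_r X) I w"
    and t: "t\<^sub>1 \<in> I" "t\<^sub>2 \<in> I"
  shows "invariants (w t\<^sub>2) = invariants (w t\<^sub>1)"
    and "w t\<^sub>2 = relax_path X \<gamma> \<epsilon> (w t\<^sub>1) (t\<^sub>2 - t\<^sub>1)"
proof -
  have cvx: "convex I" using I by (simp add: is_interval_convex)
  interpret L: bounded_linear invariants by (rule bounded_linear_invariants)
  have D: "w t \<in> Omega_r X"
    "(w has_vector_derivative - (relax_rate X \<gamma> \<epsilon> (w t) *\<^sub>R (w t - relaxed X \<gamma> (w t)))) (at t within I)"
    if "t \<in> I" for t
    using sol that relax_field_eq[OF X, of "w t" \<epsilon>] by (auto simp: ode_solution_def)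
  have "((\<lambda>t. invariants (w t)) has_vector_derivative 0) (at t within I)" if "t \<in> I" for t
    using L.has_vector_derivative[OF D(2)[OF that]] by (simp add: L.neg L.scaleR L.diff)
  then have inv: "invariants (w t) = invariants (w t\<^sub>1)" if "t \<in> I" for t
    by (rule has_vector_derivative_zero_imp_eq[OF cvx _ that t(1)])
  show "invariants (w t\<^sub>2) = invariants (w t\<^sub>1)" by (rule inv[OF t(2)])
  \<comment> \<open>Constancy of the invariants freezes target and rate at their values at
    \<open>t\<^sub>1\<close>, which leaves a linear equation with constant coefficients.\<close>
  define p where "p = relaxed X \<gamma> (w t\<^sub>1)"
  define l where "l = relax_rate X \<gamma> \<epsilon> (w t\<^sub>1)"
  have D': "(w has_vector_derivative - (l *\<^sub>R (w t - p))) (at t within I)" if "t \<in> I" for t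
    using D(2)[OF that] relaxed_cong[OF inv[OF that]] relax_rate_cong[OF inv[OF that]]
    by (simp add: p_def l_def)
  \<comment> \<open>The integrating factor \<open>exp (l * t)\<close> makes the two terms of the
    product rule cancel.\<close>
  have "((\<lambda>t. exp (l * t) *\<^sub>R (w t - p)) has_vector_derivative 0) (at t within I)" if "t \<in> I" for t
  proof -
    have "((\<lambda>t. exp (l * t) *\<^sub>R (w t - p)) has_vector_derivative
        exp (l * t) *\<^sub>R (- (l *\<^sub>R (w t - p)) - 0) + (exp (l * t) * l) *\<^sub>R (w t - p)) (at t within I)"
      by (rule has_vector_derivative_scaleR has_vector_derivative_diff D'[OF that]
          has_vector_derivative_const | (auto intro!: derivative_eq_intros))+
    then show ?thesis by simp
  qed
  then have "exp (l * t\<^sub>2) *\<^sub>R (w t\<^sub>2 - p) = exp (l * t\<^sub>1) *\<^sub>R (w t\<^sub>1 - p)"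
    by (rule has_vector_derivative_zero_imp_eq[OF cvx _ t(2,1)])
  then have "exp (- (l * t\<^sub>2)) *\<^sub>R exp (l * t\<^sub>2) *\<^sub>R (w t\<^sub>2 - p) =
      exp (- (l * t\<^sub>2)) *\<^sub>R exp (l * t\<^sub>1) *\<^sub>R (w t\<^sub>1 - p)" by simp
  then have "w t\<^sub>2 - p = exp (- (l * (t\<^sub>2 - t\<^sub>1))) *\<^sub>R (w t\<^sub>1 - p)"
    by (simp add: exp_add[symmetric] algebra_simps)
  then show "w t\<^sub>2 = relax_path X \<gamma> \<epsilon> (w t\<^sub>1) (t\<^sub>2 - t\<^sub>1)"
    by (simp add: relax_path_def p_def l_def algebra_simps)
qed

lemma relax_rate_pos:
  assumes "valid_mixture X" "\<gamma> > 5/3" "\<epsilon> > 0" "w \<in> Omega_r X"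
  shows "relax_rate X \<gamma> \<epsilon> w > 0"
  using kappa_pos[OF assms(1,2) Omega_rD[OF assms(4)]] assms(3) by (simp add: relax_rate_def)

lemma invariants_relax_path [simp]: "invariants (relax_path X \<gamma> \<epsilon> w t) = invariants w"
proof -
  interpret L: bounded_linear invariants by (rule bounded_linear_invariants)
  show ?thesis by (simp add: relax_path_def L.add L.scaleR L.diff)
qed

text \<open>For \<open>t \<ge> 0\<close> the exponential factor is at most 1, so the path stays on
  the segment from \<open>w\<close> to its target; target and rate do not change along it.\<close>

lemma ode_solution_relax_path:
  assumes X: "valid_mixture X" "\<gamma> > 5/3" "\<epsilon> > 0" and w: "w \<in> Omega_r X"
  shows "ode_solution (relax_field X \<gamma> \<epsilon>) (Omega_r X) {0..} (relax_path X \<gamma> \<epsilon> w)"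
  unfolding ode_solution_def
proof (intro ballI conjI)
  fix t :: real assume t: "t \<in> {0..}"
  let ?l = "relax_rate X \<gamma> \<epsilon> w" and ?p = "relaxed X \<gamma> w"
  show \<Omega>: "relax_path X \<gamma> \<epsilon> w t \<in> Omega_r X"
    unfolding relax_path_def
    using relax_rate_pos[OF X w] t by (intro relaxed_segment_in_Omega_r[OF X(1,2) w]) (simp_all add: less_imp_le)
  have inv: "relaxed X \<gamma> (relax_path X \<gamma> \<epsilon> w t) = ?p" "relax_rate X \<gamma> \<epsilon> (relax_path X \<gamma> \<epsilon> w t) = ?l"
    by (auto intro: relaxed_cong relax_rate_cong)
  have "((\<lambda>t. ?p + exp (- (?l * t)) *\<^sub>R (w - ?p)) has_vector_derivative
      0 + (exp (- (?l * t)) *\<^sub>R 0 + (exp (- (?l * t)) * (- ?l)) *\<^sub>R (w - ?p))) (at t within {0..})"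
    by (rule has_vector_derivative_add has_vector_derivative_scaleR has_vector_derivative_const
        | (auto intro!: derivative_eq_intros))+
  then show "(relax_path X \<gamma> \<epsilon> w has_vector_derivative relax_field X \<gamma> \<epsilon> (relax_path X \<gamma> \<epsilon> w t)) (at t within {0..})"
    unfolding relax_field_eq[OF X(1,2) \<Omega>] inv
    by (simp add: relax_path_def[abs_def] algebra_simps)
qed

section \<open>The entropy on a level set\<close>

text \<open>Isolates the dependence on \<open>er\<close> and \<open>es\<close>: the first term is
  fixed by \<open>\<rho>\<close> and \<open>q\<close>, being minus the entropy with both energies
  replaced by 1.\<close>

lemma zeta_eq:
  assumes X: "valid_mixture X" "\<gamma> > 5/3" and w: "(\<rho>, m, a, q, b) \<in> Omega_r X"
  defines "r \<equiv> r_mix X (mass_frac \<rho>)" and "k \<equiv> kappa X \<gamma> \<rho>"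
  shows "zeta X \<gamma> (\<rho>, m, a, q, b) =
     - mix_entropy X (mass_frac \<rho>) ((k * (1 / mass \<rho>) powr (\<gamma> - 1)) powr (1 / (\<gamma> - 1))) (1 / k + 1) (vib_energy X \<rho> q)
     - r / (\<gamma> - 1) * (k * ln (es (\<rho>, m, a, q, b)) + ln (er (\<rho>, m, a, q, b)))"
proof -
  have \<rho>: "\<forall>\<alpha>. \<rho> $ \<alpha> > 0" using Omega_rD[OF w] by simp
  note M = mass_pos[OF \<rho>]
  define g where "g = gamma_mix X (mass_frac \<rho>)"
  define C where "C = Cv_mix X (mass_frac \<rho>)"
  define s where "s = es (\<rho>, m, a, q, b)"
  define e where "e = er (\<rho>, m, a, q, b)"
  define T where "T = (1 / mass \<rho>) powr (\<gamma> - 1)"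
  have k: "k > 0" unfolding k_def by (rule kappa_pos[OF X \<rho>])
  have se: "s > 0" "e > 0" using w by (auto simp: Omega_r_def s_def e_def)
  have T: "T > 0" using M by (simp add: T_def)
  have g: "1 < g" "g < \<gamma>" using gamma_mix_gt[OF X(1) \<rho>] gamma_mix_le[OF X(1) \<rho>] X(2) by (auto simp: g_def)
  have C: "C > 0" and r: "r = (g - 1) * C"
    using Cv_mix_pos[OF X(1) \<rho>] by (auto simp: C_def r_def g_def gamma_mix_def)
  have kg: "k = (\<gamma> - g) / (g - 1)" by (simp add: k_def kappa_def g_def)
  have ik: "(g - 1) / (\<gamma> - g) = 1 / k" by (simp add: kg)
  have pw: "((T * e) powr (1 / \<gamma>)) powr \<gamma> = T * e"
    using T se g by (simp add: powr_powr)
  have z: "zeta X \<gamma> (\<rho>, m, a, q, b) =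
     - mix_entropy X (mass_frac \<rho>) ((k * (T * e / s)) powr (1 / (\<gamma> - 1))) (1 / k * s + s) (vib_energy X \<rho> q)"
    unfolding zeta.simps Let_def s_def[symmetric] e_def[symmetric] T_def[symmetric] g_def[symmetric]
      minus_minus pw ik kg[symmetric] ..
  have l1: "ln (1 / k * s + s) = ln (1 / k + 1) + ln s"
  proof -
    have "1 / k * s + s = (1 / k + 1) * s" by (simp add: algebra_simps)
    then show ?thesis using k se by (simp only: ln_mult_pos add_pos_pos divide_pos_pos zero_less_one)
  qed
  have l2: "ln ((k * (T * e / s)) powr (1 / (\<gamma> - 1))) =
      ln ((k * T) powr (1 / (\<gamma> - 1))) + (ln e - ln s) / (\<gamma> - 1)"
    using k T se g by (simp add: ln_powr ln_mult ln_div add_divide_distrib diff_divide_distrib)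
  \<comment> \<open>The coefficient of \<open>ln s\<close> is \<open>C - r / (\<gamma> - 1)\<close>,
    which equals \<open>r * k / (\<gamma> - 1)\<close> because
    \<open>r * k = C * (\<gamma> - g)\<close>.\<close>
  have l3: "C * ln s + r * ((ln e - ln s) / (\<gamma> - 1)) = r / (\<gamma> - 1) * (k * ln s + ln e)"
    using g unfolding r kg by (simp add: divide_simps) (simp add: algebra_simps)
  have "- (C * (x + y) + r * (u + v) + h + i) = - (C * x + r * u + h + i) - (C * y + r * v)"
    for x y u v h i
    by (simp add: algebra_simps)
  then show ?thesis
    unfolding z unfolding mix_entropy_def r_def[symmetric] C_def[symmetric] s_def[symmetric]
      e_def[symmetric] T_def[symmetric] l1 l2 l3[symmetric] .
qed

text \<open>Concavity in tangent form: the logarithms are bounded by their tangents at the moved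
  point \<open>(x', y')\<close>, and the resulting linear term is nonpositive because that point
  lies between the equilibrium and \<open>(x, y)\<close>.\<close>

lemma ln_sum_strict:
  fixes k x y x' y' \<theta> :: real
  assumes pos: "k > 0" "x > 0" "y > 0" "x\<^sub>e > 0" "y\<^sub>e > 0" and e: "x\<^sub>e = k * y\<^sub>e" "x\<^sub>e + y\<^sub>e = x + y"
    and ne: "x \<noteq> x\<^sub>e" and \<theta>: "0 \<le> \<theta>" "\<theta> < 1"
    and x': "x' = x\<^sub>e + \<theta> * (x - x\<^sub>e)" and y': "y' = y\<^sub>e + \<theta> * (y - y\<^sub>e)"
  shows "k * ln x + ln y < k * ln x' + ln y'"
proof -
  have x'_alt: "x' = (1 - \<theta>) * x\<^sub>e + \<theta> * x" and y'_alt: "y' = (1 - \<theta>) * y\<^sub>e + \<theta> * y"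
    by (simp_all add: x' y' algebra_simps)
  have p': "x' > 0" "y' > 0"
    unfolding x'_alt y'_alt using pos \<theta> by (auto intro!: add_pos_nonneg)
  have dx: "x - x' = (1 - \<theta>) * (x - x\<^sub>e)" by (simp add: x' algebra_simps)
  have "y - y' = (1 - \<theta>) * (y - y\<^sub>e)" by (simp add: y' algebra_simps)
  also have "y - y\<^sub>e = - (x - x\<^sub>e)" using e(2) by simp
  finally have dy: "y - y' = - (x - x')" unfolding dx by (simp only: mult_minus_right)
  \<comment> \<open>Strictness must come from the logarithm, since the linear term vanishes for
    \<open>\<theta> = 0\<close>.\<close>
  have "x / x' \<noteq> 1" using ne \<theta> dx p' by auto
  then have 1: "ln (x / x') < x / x' - 1"
    using ln_le_minus_one[of "x / x'"] ln_eq_minus_one[of "x / x'"] pos p' by force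
  have 2: "ln (y / y') \<le> y / y' - 1" using ln_le_minus_one pos p' by simp
  \<comment> \<open>Up to the factor \<open>x' * y'\<close> this is the derivative at
    \<open>(x', y')\<close> along the line of constant sum. It vanishes at equilibrium, hence the
    factor \<open>\<theta>\<close>.\<close>
  have "k * y' - x' = - \<theta> * (1 + k) * (x - x\<^sub>e)"
  proof -
    have "k * y' - x' = (k * y\<^sub>e - x\<^sub>e) + \<theta> * (k * (y - y\<^sub>e) - (x - x\<^sub>e))"
      by (simp add: x' y' algebra_simps)
    also have "y - y\<^sub>e = - (x - x\<^sub>e)" using e(2) by simp
    finally show ?thesis using e(1) by (simp add: algebra_simps)
  qed
  then have "(x - x') * (k * y' - x') = - (\<theta> * (1 - \<theta>) * (1 + k) * (x - x\<^sub>e)\<^sup>2)"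
    by (simp add: dx power2_eq_square)
  also have "\<dots> \<le> 0" using \<theta> pos by simp
  finally have 3: "(x - x') * (k * y' - x') \<le> 0" .
  have "k * ln (x / x') + ln (y / y') < k * (x / x' - 1) + (y / y' - 1)"
    using 1 2 pos by (intro add_less_le_mono mult_strict_left_mono)
  also have "\<dots> = k * ((x - x') / x') + (y - y') / y'" using p' by (simp add: diff_divide_distrib)
  also have "\<dots> = (x - x') * (k * y' - x') / (x' * y')"
    unfolding dy using p' by (simp add: field_simps)
  also have "\<dots> \<le> 0" using 3 p' by (simp add: divide_le_0_iff)
  finally show ?thesis using pos p' by (simp add: ln_div algebra_simps)
qed

text \<open>Serves twice: \<open>\<theta> = 0\<close> gives minimality of the target, and an
  exponential \<open>\<theta>\<close> gives decrease in time.\<close>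

lemma rho_zeta_less:
  assumes X: "valid_mixture X" "\<gamma> > 5/3" and w: "w \<in> Omega_r X" and ne: "w \<noteq> relaxed X \<gamma> w"
    and \<theta>: "0 \<le> \<theta>" "\<theta> < 1"
  shows "rho_zeta X \<gamma> (relaxed X \<gamma> w + \<theta> *\<^sub>R (w - relaxed X \<gamma> w)) < rho_zeta X \<gamma> w"
proof -
  obtain \<rho> m a q b where w_eq: "w = (\<rho>, m, a, q, b)" by (cases w)
  have \<rho>: "\<forall>\<alpha>. \<rho> $ \<alpha> > 0" using Omega_rD[OF w] w_eq by simp
  note M = mass_pos[OF \<rho>] and k = kappa_pos[OF X \<rho>]
  let ?k = "kappa X \<gamma> \<rho>"
  define b' where "b' = kappa X \<gamma> \<rho> / (1 + kappa X \<gamma> \<rho>) * (a + b - mass \<rho> * kinetic \<rho> m)"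
  define a' where "a' = a + b - b'"
  have p_eq: "relaxed X \<gamma> w = (\<rho>, m, a', q, b')" by (simp add: w_eq Let_def b'_def a'_def)
  have p: "(\<rho>, m, a', q, b') \<in> Omega_r X" using relaxed_in_Omega_r[OF X w] p_eq by simp
  \<comment> \<open>The sum \<open>a + b\<close> is common to both states, so a difference must show
    in \<open>b\<close>.\<close>
  have neb: "b \<noteq> b'" using ne p_eq w_eq a'_def by auto
  let ?w = "(\<rho>, m, a' + \<theta> * (a - a'), q, b' + \<theta> * (b - b'))"
  have w': "relaxed X \<gamma> w + \<theta> *\<^sub>R (w - relaxed X \<gamma> w) = ?w"
    unfolding p_eq by (simp add: w_eq)
  have \<Omega>: "?w \<in> Omega_r X"
    using relaxed_segment_in_Omega_r[OF X w, of \<theta>] \<theta> unfolding w' by simp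
  have "?k * ln (es w) + ln (er w) < ?k * ln (es ?w) + ln (er ?w)"
  proof (rule ln_sum_strict[where x\<^sub>e = "b' / mass \<rho>" and y\<^sub>e = "a' / mass \<rho> - kinetic \<rho> m" and \<theta> = \<theta>])
    show "b' / mass \<rho> = ?k * (a' / mass \<rho> - kinetic \<rho> m)"
      using M k by (simp add: a'_def b'_def divide_simps) (simp add: algebra_simps)
    show "b' / mass \<rho> + (a' / mass \<rho> - kinetic \<rho> m) = es w + er w"
      using M by (simp add: w_eq a'_def field_simps)
    show "0 < es w" "0 < er w" using w by (auto simp: w_eq Omega_r_def)
    show "0 < b' / mass \<rho>" "0 < a' / mass \<rho> - kinetic \<rho> m" using p by (auto simp: Omega_r_def)
    show "es w \<noteq> b' / mass \<rho>" using neb M by (simp add: w_eq)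
    show "es ?w = b' / mass \<rho> + \<theta> * (es w - b' / mass \<rho>)"
      by (simp add: w_eq add_divide_distrib diff_divide_distrib right_diff_distrib)
    show "er ?w = a' / mass \<rho> - kinetic \<rho> m + \<theta> * (er w - (a' / mass \<rho> - kinetic \<rho> m))"
      by (simp add: w_eq add_divide_distrib diff_divide_distrib right_diff_distrib)
  qed (use k \<theta> in auto)
  then have "r_mix X (mass_frac \<rho>) / (\<gamma> - 1) * (?k * ln (es w) + ln (er w)) < 
      r_mix X (mass_frac \<rho>) / (\<gamma> - 1) * (?k * ln (es ?w) + ln (er ?w))"
    using r_mix_pos[OF X(1) \<rho>] X(2) by (intro mult_strict_left_mono) auto
  then show ?thesis
    unfolding w' unfolding w_eq rho_zeta.simps zeta_eq[OF X \<Omega>] zeta_eq[OF X w[unfolded w_eq]]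
    using M by (intro mult_strict_left_mono) auto
qed

text \<open>The form in \<open>zeta_eq\<close> reduces the limit to continuity of \<open>ln\<close>
  at the positive energies of the target.\<close>

lemma rho_zeta_relax_path_tendsto:
  assumes X: "valid_mixture X" "\<gamma> > 5/3" "\<epsilon> > 0" and w: "w \<in> Omega_r X"
  shows "(relax_path X \<gamma> \<epsilon> w \<longlongrightarrow> relaxed X \<gamma> w) at_top"
    and "((\<lambda>t. rho_zeta X \<gamma> (relax_path X \<gamma> \<epsilon> w t)) \<longlongrightarrow> rho_zeta X \<gamma> (relaxed X \<gamma> w)) at_top"
proof -
  let ?\<theta> = "\<lambda>t. exp (- (relax_rate X \<gamma> \<epsilon> w * t))"
  have \<theta>: "(?\<theta> \<longlongrightarrow> 0) at_top"
    using relax_rate_pos[OF X w]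
    by (intro filterlim_compose[OF exp_at_bot] filterlim_compose[OF filterlim_uminus_at_bot_at_top]
        filterlim_tendsto_pos_mult_at_top[OF tendsto_const] filterlim_ident)
  have "(relax_path X \<gamma> \<epsilon> w \<longlongrightarrow> relaxed X \<gamma> w + 0 *\<^sub>R (w - relaxed X \<gamma> w)) at_top"
    unfolding relax_path_def[abs_def] by (intro tendsto_intros \<theta>)
  then show "(relax_path X \<gamma> \<epsilon> w \<longlongrightarrow> relaxed X \<gamma> w) at_top" by simp
  obtain \<rho> m a q b where w_eq: "w = (\<rho>, m, a, q, b)" by (cases w)
  obtain a' b' where p_eq: "relaxed X \<gamma> w = (\<rho>, m, a', q, b')" using w_eq by (simp add: Let_def)
  have p: "(\<rho>, m, a', q, b') \<in> Omega_r X" using relaxed_in_Omega_r[OF X(1,2) w] p_eq by simp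
  have \<rho>: "\<forall>\<alpha>. \<rho> $ \<alpha> > 0" using Omega_rD[OF w] w_eq by simp
  note M = mass_pos[OF \<rho>]
  let ?p = "\<lambda>t. (\<rho>, m, a' + ?\<theta> t * (a - a'), q, b' + ?\<theta> t * (b - b'))"
  have path: "relax_path X \<gamma> \<epsilon> w t = ?p t" for t
    unfolding relax_path_def p_eq by (simp add: w_eq)
  have \<Omega>: "?p t \<in> Omega_r X" if "t \<ge> 0" for t
    using ode_solution_relax_path[OF X w] that unfolding path[symmetric] by (auto simp: ode_solution_def)
  let ?r = "r_mix X (mass_frac \<rho>) / (\<gamma> - 1)" and ?k = "kappa X \<gamma> \<rho>"
  let ?Z = "- mix_entropy X (mass_frac \<rho>) ((?k * (1 / mass \<rho>) powr (\<gamma> - 1)) powr (1 / (\<gamma> - 1)))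
     (1 / ?k + 1) (vib_energy X \<rho> q)"
  have "((\<lambda>t. mass \<rho> * (?Z - ?r * (?k * ln ((b' + ?\<theta> t * (b - b')) / mass \<rho>)
           + ln ((a' + ?\<theta> t * (a - a')) / mass \<rho> - kinetic \<rho> m)))) \<longlongrightarrow>
        mass \<rho> * (?Z - ?r * (?k * ln ((b' + 0 * (b - b')) / mass \<rho>)
           + ln ((a' + 0 * (a - a')) / mass \<rho> - kinetic \<rho> m)))) at_top"
    using M p by (intro tendsto_intros \<theta>) (auto simp: Omega_r_iff field_simps)
  also have "mass \<rho> * (?Z - ?r * (?k * ln ((b' + 0 * (b - b')) / mass \<rho>)
           + ln ((a' + 0 * (a - a')) / mass \<rho> - kinetic \<rho> m))) = rho_zeta X \<gamma> (relaxed X \<gamma> w)"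
    unfolding p_eq rho_zeta.simps zeta_eq[OF X(1,2) p] by simp
  finally show "((\<lambda>t. rho_zeta X \<gamma> (relax_path X \<gamma> \<epsilon> w t)) \<longlongrightarrow> rho_zeta X \<gamma> (relaxed X \<gamma> w)) at_top"
  \<comment> \<open>That form holds inside \<open>Omega_r\<close>, where the path is known to lie
    for \<open>t \<ge> 0\<close>; eventual equality is enough.\<close>
  proof (rule Lim_transform_eventually)
    show "\<forall>\<^sub>F t in at_top. mass \<rho> * (?Z - ?r * (?k * ln ((b' + ?\<theta> t * (b - b')) / mass \<rho>)
           + ln ((a' + ?\<theta> t * (a - a')) / mass \<rho> - kinetic \<rho> m))) = rho_zeta X \<gamma> (relax_path X \<gamma> \<epsilon> w t)"
      using eventually_ge_at_top[of 0]
    proof eventually_elim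
      case (elim t)
      show ?case unfolding path rho_zeta.simps zeta_eq[OF X(1,2) \<Omega>[OF elim]] by simp
    qed
  qed
qed

section \<open>Continuity of the target and Lyapunov stability\<close>

lemma relaxed_eq:
  "relaxed X \<gamma> w =
     (let \<rho> = fst w; c = fst (snd (snd w)) + snd (snd (snd (snd w)));
          b' = kappa X \<gamma> \<rho> / (1 + kappa X \<gamma> \<rho>) * (c - mass \<rho> * kinetic \<rho> (fst (snd w)))
      in (\<rho>, fst (snd w), c - b', fst (snd (snd (snd w))), b'))"
  by (cases w) (simp add: Let_def)

text \<open>The denominators \<open>mass\<close>, \<open>Cv_mix\<close>,
  \<open>gamma_mix - 1\<close> and \<open>1 + kappa\<close> are all nonzero at
  \<open>p\<close>.\<close>

lemma isCont_relaxed: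
  fixes p :: "('s::finite, 'd::finite, 'b::finite) relax_state"
  assumes X: "valid_mixture X" "\<gamma> > 5/3" and p: "p \<in> Omega_r X"
  shows "isCont (relaxed X \<gamma>) p"
proof -
  have \<rho>: "\<forall>\<alpha>. fst p $ \<alpha> > 0" by (rule Omega_rD[OF p])
  have M: "mass (fst p) \<noteq> 0" using mass_pos[OF \<rho>] by simp
  have C: "Cv_mix X (mass_frac (fst p)) \<noteq> 0" using Cv_mix_pos[OF X(1) \<rho>] by simp
  have G: "gamma_mix X (mass_frac (fst p)) - 1 \<noteq> 0" using gamma_mix_gt[OF X(1) \<rho>] by simp
  have K: "1 + kappa X \<gamma> (fst p) \<noteq> 0" using kappa_pos[OF X \<rho>] by simp
  have m: "isCont (\<lambda>w. mass (fst w)) p" unfolding mass_def by (intro continuous_intros)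
  have y: "isCont (\<lambda>w. mass_frac (fst w) $ \<alpha>) p" for \<alpha>
    unfolding mass_frac_def vec_lambda_beta by (intro continuous_intros m M)
  have r: "isCont (\<lambda>w. r_mix X (mass_frac (fst w))) p" and c: "isCont (\<lambda>w. Cv_mix X (mass_frac (fst w))) p"
    unfolding r_mix_def Cv_mix_def by (intro continuous_intros y)+
  have g: "isCont (\<lambda>w. gamma_mix X (mass_frac (fst w))) p"
    unfolding gamma_mix_def by (intro continuous_intros r c C)
  have k: "isCont (\<lambda>w. kappa X \<gamma> (fst w)) p"
    unfolding kappa_def by (intro continuous_intros g G)
  have "isCont (\<lambda>w. kinetic (fst w) (fst (snd w))) p"
    unfolding kinetic_def by (intro continuous_intros m M)
  then show ?thesis
    unfolding relaxed_eq[abs_def] Let_def by (intro continuous_intros m k K)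
qed

text \<open>A perturbed initial state may lie in another level set and then tends to another
  equilibrium. Continuity keeps that equilibrium near \<open>p\<close>, and the trajectory runs on
  the segment between two points near \<open>p\<close>.\<close>

lemma lyapunov_stable_relaxed:
  assumes X: "valid_mixture X" "\<gamma> > 5/3" "\<epsilon> > 0" and p: "p \<in> Omega_r X" "relaxed X \<gamma> p = p"
  shows "lyapunov_stable (relax_field X \<gamma> \<epsilon>) (Omega_r X) p"
  unfolding lyapunov_stable_def
proof (intro conjI allI impI)
  show "p \<in> Omega_r X" "relax_field X \<gamma> \<epsilon> p = 0"
    using p relax_field_eq[OF X(1,2) p(1)] by auto
  fix \<eta> :: real assume \<eta>: "\<eta> > 0"
  obtain d where d: "d > 0" "\<And>x. dist x p < d \<Longrightarrow> dist (relaxed X \<gamma> x) p < \<eta>"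
    using isCont_relaxed[OF X(1,2) p(1)] \<eta> p(2) unfolding continuous_at_eps_delta by metis
  show "\<exists>\<delta>>0. \<forall>x\<^sub>0\<in>Omega_r X. dist x\<^sub>0 p < \<delta> \<longrightarrow>
        (\<exists>x. ode_solution (relax_field X \<gamma> \<epsilon>) (Omega_r X) {0..} x \<and> x 0 = x\<^sub>0) \<and>
        (\<forall>I x. is_interval I \<and> 0 \<in> I \<and> I \<subseteq> {0..} \<and>
           ode_solution (relax_field X \<gamma> \<epsilon>) (Omega_r X) I x \<and> x 0 = x\<^sub>0 \<longrightarrow>
           (\<forall>t\<in>I. dist (x t) p < \<eta>))"
  \<comment> \<open>The bound \<open>d\<close> controls the target of \<open>x\<^sub>0\<close>, and
    \<open>\<eta>\<close> controls \<open>x\<^sub>0\<close> itself; convexity of the ball covers the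
    points between.\<close>
  proof (intro exI[of _ "min d \<eta>"] conjI ballI impI allI)
    fix x\<^sub>0 assume x0: "x\<^sub>0 \<in> Omega_r X" "dist x\<^sub>0 p < min d \<eta>"
    show "\<exists>x. ode_solution (relax_field X \<gamma> \<epsilon>) (Omega_r X) {0..} x \<and> x 0 = x\<^sub>0"
      by (rule exI[of _ "relax_path X \<gamma> \<epsilon> x\<^sub>0"])
        (simp add: ode_solution_relax_path[OF X x0(1)], simp add: relax_path_def)
    fix I x t
    assume "is_interval I \<and> 0 \<in> I \<and> I \<subseteq> {0..} \<and>
      ode_solution (relax_field X \<gamma> \<epsilon>) (Omega_r X) I x \<and> x 0 = x\<^sub>0" and t: "t \<in> I"
    then have xt: "x t = relax_path X \<gamma> \<epsilon> x\<^sub>0 t" and "t \<ge> 0"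
      using solution_eq(2)[OF X(1,2), of I \<epsilon> x 0 t] by auto
    let ?\<theta> = "exp (- (relax_rate X \<gamma> \<epsilon> x\<^sub>0 * t))"
    have "?\<theta> \<le> 1" using relax_rate_pos[OF X x0(1)] \<open>t \<ge> 0\<close> by simp
    then have "(1 - ?\<theta>) *\<^sub>R relaxed X \<gamma> x\<^sub>0 + ?\<theta> *\<^sub>R x\<^sub>0 \<in> ball p \<eta>"
      using d(2)[of x\<^sub>0] x0 by (intro convexD_alt[OF convex_ball]) (auto simp: dist_commute)
    then show "dist (x t) p < \<eta>"
      by (simp add: xt relax_path_def dist_commute algebra_simps)
  qed (use d \<eta> in auto)
qed

section \<open>Entropy decay, minimum and attraction\<close>

text \<open>The later state lies on the segment from the earlier one to the target, with parameter
  below 1, so \<open>rho_zeta_less\<close> applies unless the solution is stationary.\<close>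

lemma solution_entropy:
  assumes X: "valid_mixture X" "\<gamma> > 5/3" "\<epsilon> > 0"
    and I: "is_interval I" and sol: "ode_solution (relax_field X \<gamma> \<epsilon>) (Omega_r X) I w"
    and t: "t\<^sub>1 \<in> I" "t\<^sub>2 \<in> I"
  shows cons_var_solution: "cons_var X (w t\<^sub>1) = cons_var X (w t\<^sub>2)"
    and rho_zeta_solution_le: "t\<^sub>1 < t\<^sub>2 \<Longrightarrow> rho_zeta X \<gamma> (w t\<^sub>2) \<le> rho_zeta X \<gamma> (w t\<^sub>1)"
    and rho_zeta_solution_less: "t\<^sub>1 < t\<^sub>2 \<Longrightarrow> \<not> equilibrium X \<gamma> (cons_var X (w t\<^sub>1)) (w t\<^sub>1) \<Longrightarrow>
      rho_zeta X \<gamma> (w t\<^sub>2) < rho_zeta X \<gamma> (w t\<^sub>1)"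
proof -
  have \<Omega>: "w t\<^sub>1 \<in> Omega_r X" using sol t by (auto simp: ode_solution_def)
  note sol_eq = solution_eq[OF X(1,2) I sol t]
  show "cons_var X (w t\<^sub>1) = cons_var X (w t\<^sub>2)"
    using sol_eq(1) by (simp add: cons_var_eq_iff[OF Omega_rD[OF \<Omega>]])
  have less: "rho_zeta X \<gamma> (w t\<^sub>2) < rho_zeta X \<gamma> (w t\<^sub>1)"
    if "t\<^sub>1 < t\<^sub>2" "w t\<^sub>1 \<noteq> relaxed X \<gamma> (w t\<^sub>1)"
  proof -
    have "exp (- (relax_rate X \<gamma> \<epsilon> (w t\<^sub>1) * (t\<^sub>2 - t\<^sub>1))) < 1"
      using that(1) relax_rate_pos[OF X \<Omega>] by simp
    then show ?thesis
      unfolding sol_eq(2) relax_path_def by (intro rho_zeta_less[OF X(1,2) \<Omega> that(2)]) auto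
  qed
  show "rho_zeta X \<gamma> (w t\<^sub>2) \<le> rho_zeta X \<gamma> (w t\<^sub>1)" if "t\<^sub>1 < t\<^sub>2"
  proof (cases "w t\<^sub>1 = relaxed X \<gamma> (w t\<^sub>1)")
    case True
    then have "w t\<^sub>2 = w t\<^sub>1" using sol_eq(2) by (simp add: relax_path_def)
    then show ?thesis by simp
  qed (use less that in simp)
  show "rho_zeta X \<gamma> (w t\<^sub>2) < rho_zeta X \<gamma> (w t\<^sub>1)"
    if "t\<^sub>1 < t\<^sub>2" "\<not> equilibrium X \<gamma> (cons_var X (w t\<^sub>1)) (w t\<^sub>1)"
    using less that equilibrium_iff[OF X(1,2) \<Omega>] by blast
qed

lemma relaxed_attracting_minimum:
  fixes w\<^sub>0 :: "('s::finite, 'd::finite, 'b::finite) relax_state"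
  assumes X: "valid_mixture X" "\<gamma> > 5/3" "\<epsilon> > 0" and w0: "w\<^sub>0 \<in> Omega_r X"
  shows is_arg_min_rho_zeta_iff: "is_arg_min (rho_zeta X \<gamma>)
      (\<lambda>w'. w' \<in> Omega_r X \<and> cons_var X w' = cons_var X w\<^sub>0) w \<longleftrightarrow> w = relaxed X \<gamma> w\<^sub>0"
    and solution_exists: "\<exists>w. ode_solution (relax_field X \<gamma> \<epsilon>) (Omega_r X) {0..} w \<and> w 0 = w\<^sub>0"
    and solution_tendsto: "ode_solution (relax_field X \<gamma> \<epsilon>) (Omega_r X) {0..} v \<and> v 0 = w\<^sub>0 \<Longrightarrow>
      (v \<longlongrightarrow> relaxed X \<gamma> w\<^sub>0) at_top \<and>
      ((\<lambda>t. rho_zeta X \<gamma> (v t)) \<longlongrightarrow> rho_zeta X \<gamma> (relaxed X \<gamma> w\<^sub>0)) at_top"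
    and relaxed_stable: "lyapunov_stable (relax_field X \<gamma> \<epsilon>) (Omega_r X) (relaxed X \<gamma> w\<^sub>0)"
proof -
  let ?p = "relaxed X \<gamma> w\<^sub>0"
  have p: "?p \<in> Omega_r X" by (rule relaxed_in_Omega_r[OF X(1,2) w0])
  have fiber: "cons_var X w' = cons_var X w\<^sub>0 \<longleftrightarrow> invariants w' = invariants w\<^sub>0" for w' :: "('s, 'd, 'b) relax_state"
    using cons_var_eq_iff[OF Omega_rD[OF w0], of X w'] by auto
  \<comment> \<open>The case \<open>\<theta> = 0\<close> compares an arbitrary state of the level
    set with the common target, which yields both existence and uniqueness of the minimizer.\<close>
  have less: "rho_zeta X \<gamma> ?p < rho_zeta X \<gamma> w"
    if "w \<in> Omega_r X" "invariants w = invariants w\<^sub>0" "w \<noteq> ?p" for w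
    using rho_zeta_less[OF X(1,2) that(1), of 0] relaxed_cong[OF that(2), of X \<gamma>] that(3) by simp
  show "is_arg_min (rho_zeta X \<gamma>)
      (\<lambda>w'. w' \<in> Omega_r X \<and> cons_var X w' = cons_var X w\<^sub>0) w \<longleftrightarrow> w = ?p"
    unfolding is_arg_min_def fiber
    by (metis less less_asym p invariants_relaxed)
  show "\<exists>w. ode_solution (relax_field X \<gamma> \<epsilon>) (Omega_r X) {0..} w \<and> w 0 = w\<^sub>0"
    by (rule exI[of _ "relax_path X \<gamma> \<epsilon> w\<^sub>0"])
      (simp add: ode_solution_relax_path[OF X w0], simp add: relax_path_def)
  show "(v \<longlongrightarrow> ?p) at_top \<and> ((\<lambda>t. rho_zeta X \<gamma> (v t)) \<longlongrightarrow> rho_zeta X \<gamma> ?p) at_top"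
    if "ode_solution (relax_field X \<gamma> \<epsilon>) (Omega_r X) {0..} v \<and> v 0 = w\<^sub>0"
  proof -
    have eq: "v t = relax_path X \<gamma> \<epsilon> w\<^sub>0 t" if "t \<ge> 0" for t
      using solution_eq(2)[OF X(1,2), of "{0..}" \<epsilon> v 0 t] that
        \<open>ode_solution _ _ _ v \<and> _\<close> by (simp add: is_interval_ci)
    then have "\<forall>\<^sub>F t in at_top. relax_path X \<gamma> \<epsilon> w\<^sub>0 t = v t"
      by (intro eventually_mono[OF eventually_ge_at_top[of 0]]) simp
    then show ?thesis
      using rho_zeta_relax_path_tendsto[OF X w0]
      by (intro conjI; elim Lim_transform_eventually) (auto elim: eventually_mono)
  qed
  show "lyapunov_stable (relax_field X \<gamma> \<epsilon>) (Omega_r X) ?p"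
    by (rule lyapunov_stable_relaxed[OF X p relaxed_cong]) simp
qed

theorem theorem4p1:
  fixes X :: "('s::finite, 'b::finite) mixture"
    and \<gamma> \<epsilon> :: real
  assumes "valid_mixture X" and "\<gamma> > 5/3" and "\<epsilon> > 0"
  shows
    "(\<forall>I (w :: real \<Rightarrow> ('s, 'd::finite, 'b) relax_state).
        is_interval I \<and> ode_solution (relax_field X \<gamma> \<epsilon>) (Omega_r X) I w \<longrightarrow>
          (\<forall>t\<^sub>1\<in>I. \<forall>t\<^sub>2\<in>I. cons_var X (w t\<^sub>1) = cons_var X (w t\<^sub>2)) \<and>
          (\<forall>t\<^sub>1\<in>I. \<forall>t\<^sub>2\<in>I. t\<^sub>1 < t\<^sub>2 \<longrightarrow>
             rho_zeta X \<gamma> (w t\<^sub>2) \<le> rho_zeta X \<gamma> (w t\<^sub>1) \<and>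
             (\<not> equilibrium X \<gamma> (cons_var X (w t\<^sub>1)) (w t\<^sub>1) \<longrightarrow>
                rho_zeta X \<gamma> (w t\<^sub>2) < rho_zeta X \<gamma> (w t\<^sub>1)))) \<and>
     (\<forall>w\<^sub>0 \<in> (Omega_r X :: ('s, 'd, 'b) relax_state set).
        \<exists>w\<^sub>e.
          (\<forall>w. equilibrium X \<gamma> (cons_var X w\<^sub>0) w \<longleftrightarrow> w = w\<^sub>e) \<and>
          (\<forall>w. is_arg_min (rho_zeta X \<gamma>)
                  (\<lambda>w'. w' \<in> Omega_r X \<and> cons_var X w' = cons_var X w\<^sub>0) w \<longleftrightarrow> w = w\<^sub>e) \<and>
          (\<exists>w. ode_solution (relax_field X \<gamma> \<epsilon>) (Omega_r X) {0..} w \<and> w 0 = w\<^sub>0) \<and>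
          (\<forall>w. ode_solution (relax_field X \<gamma> \<epsilon>) (Omega_r X) {0..} w \<and> w 0 = w\<^sub>0 \<longrightarrow>
             (w \<longlongrightarrow> w\<^sub>e) at_top \<and>
             ((\<lambda>t. rho_zeta X \<gamma> (w t)) \<longlongrightarrow> rho_zeta X \<gamma> w\<^sub>e) at_top) \<and>
          lyapunov_stable (relax_field X \<gamma> \<epsilon>) (Omega_r X) w\<^sub>e)" (is "?A \<and> (\<forall>w\<^sub>0\<in>_. \<exists>w\<^sub>e. ?B w\<^sub>0 w\<^sub>e)")
proof (rule conjI)
  show ?A
  \<comment> \<open>Three goals arise: conservation, weak decrease and strict decrease off
    equilibrium.\<close>
  proof (intro allI impI, elim conjE, intro conjI ballI impI)
  qed (rule solution_entropy[OF assms]; assumption)+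
  show "\<forall>w\<^sub>0\<in>Omega_r X. \<exists>w\<^sub>e. ?B w\<^sub>0 w\<^sub>e"
  proof (rule ballI)
    fix w\<^sub>0 :: "('s, 'd, 'b) relax_state" assume w0: "w\<^sub>0 \<in> Omega_r X"
    have "?B w\<^sub>0 (relaxed X \<gamma> w\<^sub>0)"
      by (intro conjI allI impI equilibrium_iff[OF assms(1,2) w0] relaxed_stable[OF assms w0]
          is_arg_min_rho_zeta_iff[OF assms w0] solution_exists[OF assms w0]
          solution_tendsto[OF assms w0, THEN conjunct1] solution_tendsto[OF assms w0, THEN conjunct2])
        auto
    then show "\<exists>w\<^sub>e. ?B w\<^sub>0 w\<^sub>e" by (rule exI[of "?B w\<^sub>0"])
  qed
qed

end
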